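(* Let $\mathcal A=(A,*,\alpha)$ be a multiplicative right Hom-alternative superalgebra. Then $\mathcal A$ is Hom-Jordan-admissible, i.e. its plus Hom-superalgebra $\mathcal A^+=(A,\circ,\alpha)$, where $x\circ y:=\tfrac12\big(x*y+(-1)^{\bar x\bar y}y*x\big)$ for homogeneous $x,y$, is a Hom-Jordan superalgebra.
   Context: All vector spaces are over a fixed field of characteristic not $2$ or $3$. A superspace is a $\mathbb Z_2$-graded vector space $A=A_0\oplus A_1$; $\bar x$ is the degree of a homogeneous $x$. A multiplicative Hom-superalgebra $(A,*,\alpha)$ is a superspace $A$ with a bilinear product satisfying $A_i*A_j\subseteq A_{i+j}$ and an even (degree-preserving) linear map $\alpha:A\to A$ with $\alpha(x*y)=\alpha(x)*\alpha(y)$. Its Hom-associator is $as_{\mathcal A}(x,y,z)=(x*y)*\alpha(z)-\alpha(x)*(y*z)$. It is right Hom-alternative if $as_{\mathcal A}(x,y,z)=-(-1)^{\bar y\bar z}as_{\mathcal A}(x,z,y)$ for all homogeneous $x,y,z$. A Hom-Jordan superalgebra is a Hom-superalgebra $(A,\cdot,\alpha)$ that is supercommutative, $x\cdot y=(-1)^{\bar x\bar y}y\cdot x$, and satisfies, for all homogeneous $x,y,z,t$, $$\circlearrowleft_{x,y,t}(-1)^{\bar t(\bar x+\bar z)}as(x\cdot y,\alpha(z),\alpha(t))=0,$$ where $as$ is the Hom-associator of $(A,\cdot,\alpha)$ and $\circlearrowleft_{x,y,t}$ is the sum over cyclic permutations of $x,y,t$ (the degrees in the signs being permuted accordingly). 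*)

theory Defs
  imports
    "HOL-Library.Z2"
    "HOL-Computational_Algebra.Computational_Algebra"
begin

text \<open>
  The grading group is the type \<^typ>\<open>bit\<close> of integers mod 2, and \<^term>\<open>A i\<close> is the homogeneous
  component of degree \<^term>\<open>i\<close>. As in all conditions below, "for all homogeneous elements" is
  expressed by quantifying over degrees and over the elements of the corresponding components, so
  that the zero vector is homogeneous of either degree.
\<close>

locale superspace = vector_space scale
  for scale :: "'k::field \<Rightarrow> 'a::ab_group_add \<Rightarrow> 'a" +
  fixes A :: "bit \<Rightarrow> 'a set"
  assumes subspace_component: "subspace (A i)"
    and components_Int: "A 0 \<inter> A 1 = {0}"
    and components_span: "\<exists>a\<in>A 0. \<exists>b\<in>A 1. x = a + b"

text \<open>The projection of \<^term>\<open>x\<close> to the component of degree \<^term>\<open>i\<close>.\<close>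

definition component :: "(bit \<Rightarrow> 'a::ab_group_add set) \<Rightarrow> bit \<Rightarrow> 'a \<Rightarrow> 'a" where
  "component A i x = (THE y. y \<in> A i \<and> x - y \<in> A (i + 1))"

text \<open>The scalar $(-1)^i$ for a degree \<^term>\<open>i\<close>.\<close>

definition deg_sign :: "bit \<Rightarrow> 'k::field" where
  "deg_sign i = (if i = 0 then 1 else - 1)"

definition hom_associator ::
    "('a::ab_group_add \<Rightarrow> 'a \<Rightarrow> 'a) \<Rightarrow> ('a \<Rightarrow> 'a) \<Rightarrow> 'a \<Rightarrow> 'a \<Rightarrow> 'a \<Rightarrow> 'a" where
  "hom_associator m \<alpha> x y z = m (m x y) (\<alpha> z) - m (\<alpha> x) (m y z)"

text \<open>Multiplicativity of the twisting map is not part of the notion of a Hom-superalgebra.\<close>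

locale hom_superalgebra = superspace scale A
  for scale :: "'k::field \<Rightarrow> 'a::ab_group_add \<Rightarrow> 'a" and A :: "bit \<Rightarrow> 'a set" +
  fixes m :: "'a \<Rightarrow> 'a \<Rightarrow> 'a" and \<alpha> :: "'a \<Rightarrow> 'a"
  assumes linear_left: "Vector_Spaces.linear scale scale (\<lambda>x. m x y)"
    and linear_right: "Vector_Spaces.linear scale scale (m x)"
    and mult_even: "x \<in> A i \<Longrightarrow> y \<in> A j \<Longrightarrow> m x y \<in> A (i + j)"
    and linear_twist: "Vector_Spaces.linear scale scale \<alpha>"
    and twist_even: "x \<in> A i \<Longrightarrow> \<alpha> x \<in> A i"

locale multiplicative_hom_superalgebra = hom_superalgebra +
  assumes twist_mult: "\<alpha> (m x y) = m (\<alpha> x) (\<alpha> y)"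

locale right_hom_alternative_superalgebra = hom_superalgebra +
  assumes right_hom_alternative:
    "\<lbrakk>x \<in> A i; y \<in> A j; z \<in> A k\<rbrakk> \<Longrightarrow>
      hom_associator m \<alpha> x y z = - scale (deg_sign (j * k)) (hom_associator m \<alpha> x z y)"

locale hom_jordan_superalgebra = hom_superalgebra +
  assumes supercommutative:
    "\<lbrakk>x \<in> A i; y \<in> A j\<rbrakk> \<Longrightarrow> m x y = scale (deg_sign (i * j)) (m y x)"
    and hom_jordan_identity:
    "\<lbrakk>x \<in> A i; y \<in> A j; z \<in> A k; t \<in> A l\<rbrakk> \<Longrightarrow>
      scale (deg_sign (l * (i + k))) (hom_associator m \<alpha> (m x y) (\<alpha> z) (\<alpha> t)) +
      scale (deg_sign (i * (j + k))) (hom_associator m \<alpha> (m y t) (\<alpha> z) (\<alpha> x)) +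
      scale (deg_sign (j * (l + k))) (hom_associator m \<alpha> (m t x) (\<alpha> z) (\<alpha> y)) = 0"

text \<open>
  The product of the plus Hom-superalgebra is given by
  $\frac12 (x * y + (-1)^{ij} y * x)$ for \<^term>\<open>x\<close> of degree \<^term>\<open>i\<close> and \<^term>\<open>y\<close> of degree
  \<^term>\<open>j\<close> (see the lemma \<open>plus_product_homogeneous\<close> below), and it is extended bilinearly to
  arbitrary elements by summing over their homogeneous components.
\<close>

definition plus_product ::
    "('k::field \<Rightarrow> 'a::ab_group_add \<Rightarrow> 'a) \<Rightarrow> (bit \<Rightarrow> 'a set) \<Rightarrow> ('a \<Rightarrow> 'a \<Rightarrow> 'a) \<Rightarrow> 'a \<Rightarrow> 'a \<Rightarrow> 'a"
  where
  "plus_product scale A m x y =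
    (\<Sum>i\<in>{0, 1}. \<Sum>j\<in>{0, 1}.
      scale (1 / 2) (m (component A i x) (component A j y) +
        scale (deg_sign (i * j)) (m (component A j y) (component A i x))))"

definition hom_jordan_admissible ::
    "('k::field \<Rightarrow> 'a::ab_group_add \<Rightarrow> 'a) \<Rightarrow> (bit \<Rightarrow> 'a set) \<Rightarrow> ('a \<Rightarrow> 'a \<Rightarrow> 'a) \<Rightarrow> ('a \<Rightarrow> 'a) \<Rightarrow> bool"
  where
  "hom_jordan_admissible scale A m \<alpha> \<longleftrightarrow>
    hom_jordan_superalgebra scale A (plus_product scale A m) \<alpha>"

context superspace
begin

lemma component_eqI:
  assumes "y \<in> A i" "x - y \<in> A (i + 1)"
  shows "component A i x = y"
  unfolding component_def
proof (rule the_equality)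
  fix w assume w: "w \<in> A i \<and> x - w \<in> A (i + 1)"
  have "w - y \<in> A i"
    using w assms(1) subspace_component subspace_diff by blast
  moreover have "(x - y) - (x - w) \<in> A (i + 1)"
    using w assms(2) subspace_component subspace_diff by blast
  then have "w - y \<in> A (i + 1)" by simp
  ultimately have "w - y \<in> A 0 \<inter> A 1" by (cases i) simp_all
  then show "w = y" using components_Int by simp
qed (use assms in simp)

lemma component_homogeneous:
  assumes "x \<in> A i"
  shows "component A j x = (if j = i then x else 0)"
proof (cases "j = i")
  case True
  then show ?thesis
    using assms subspace_0[OF subspace_component] by (auto intro!: component_eqI)
next
  case False
  then have "j + 1 = i" by (cases i; cases j) auto
  then show ?thesis
    using False assms subspace_0[OF subspace_component] by (auto intro!: component_eqI)
qed

end

lemma (in hom_superalgebra) plus_product_homogeneous: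
  assumes "x \<in> A i" "y \<in> A j"
  shows "plus_product scale A m x y = scale (1 / 2) (m x y + scale (deg_sign (i * j)) (m y x))"
proof -
  have m0: "m 0 v = 0" "m v 0 = 0" for v
  proof -
    interpret l: Vector_Spaces.linear scale scale "\<lambda>x. m x v" by (rule linear_left)
    interpret r: Vector_Spaces.linear scale scale "m v" by (rule linear_right)
    show "m 0 v = 0" "m v 0 = 0" by (rule l.zero, rule r.zero)
  qed
  show ?thesis
    unfolding plus_product_def component_homogeneous[OF assms(1)] component_homogeneous[OF assms(2)]
    by (cases i; cases j) (simp_all add: m0)
qed

end

theory Submission
  imports Defs
begin

text \<open>
  Write \<open>R\<^sub>y\<close> for right multiplication by \<open>y\<close>. Right Hom-alternativity makes \<open>y \<mapsto> R\<^sub>y\<close> a twisted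
  homomorphism from the plus algebra to operators with the super-anticommutator. Together with
  multiplicativity this rewrites every product of degree four occurring in the Hom-Jordan identity
  as a combination of left-normed words $((a * b) * \alpha(c)) * \alpha^2(d)$, as if the plus
  algebra were special, and these words cancel in the cyclic sum.
\<close>

section \<open>Linearity of the projections to the graded components\<close>

context superspace
begin

text \<open>This justifies the definite description in \<open>component\<close>: the direct sum
  decomposition supplies a witness, and \<open>component_eqI\<close> its uniqueness.\<close>

lemma component_decomp: "component A i x \<in> A i" "x - component A i x \<in> A (i + 1)"
proof -
  obtain a b where ab: "a \<in> A 0" "b \<in> A 1" "x = a + b"
    using components_span by blast
  have "\<exists>y. y \<in> A i \<and> x - y \<in> A (i + 1)"
    \<comment> \<open>For \<open>i = 1\<close> the remainder is \<open>a\<close>, which lies in the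
      required component because \<open>1 + 1 = 0\<close> in \<open>bit\<close>.\<close>
    by (rule exI[of _ "if i = 0 then a else b"]) (use ab in \<open>cases i; auto\<close>)
  then obtain y where "y \<in> A i" "x - y \<in> A (i + 1)" by blast
  then show "component A i x \<in> A i" "x - component A i x \<in> A (i + 1)"
    using component_eqI by auto
qed

text \<open>\<open>plus_product\<close> is defined on arbitrary elements through their components,
  so its bilinearity rests on the projections being linear.\<close>

lemma component_add: "component A i (x + y) = component A i x + component A i y"
proof (rule component_eqI)
  have "(x - component A i x) + (y - component A i y) \<in> A (i + 1)"
    by (intro subspace_add[OF subspace_component] component_decomp)
  then show "x + y - (component A i x + component A i y) \<in> A (i + 1)"
    by (simp add: algebra_simps)
qed (intro subspace_add[OF subspace_component] component_decomp)

lemma component_scale: "component A i (scale c x) = scale c (component A i x)"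
proof (rule component_eqI)
  have "scale c (x - component A i x) \<in> A (i + 1)"
    by (intro subspace_scale[OF subspace_component] component_decomp)
  then show "scale c x - scale c (component A i x) \<in> A (i + 1)"
    by (simp add: scale_right_diff_distrib)
qed (intro subspace_scale[OF subspace_component] component_decomp)

end

section \<open>The plus product as a supercommutative Hom-superalgebra product\<close>

context hom_superalgebra
begin

lemma mult_add_left: "m (x + y) z = m x z + m y z"
  and mult_scale_left: "m (scale c x) z = scale c (m x z)"
proof -
  interpret Vector_Spaces.linear scale scale "\<lambda>x. m x z" by (rule linear_left)
  show "m (x + y) z = m x z + m y z" "m (scale c x) z = scale c (m x z)"
    by (rule add, rule scale)
qed

lemma mult_add_right: "m z (x + y) = m z x + m z y"
  and mult_scale_right: "m z (scale c x) = scale c (m z x)"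
proof -
  interpret Vector_Spaces.linear scale scale "m z" by (rule linear_right)
  show "m z (x + y) = m z x + m z y" "m z (scale c x) = scale c (m z x)"
    by (rule add, rule scale)
qed

lemma twist_add: "\<alpha> (x + y) = \<alpha> x + \<alpha> y"
  and twist_scale: "\<alpha> (scale c x) = scale c (\<alpha> x)"
proof -
  interpret Vector_Spaces.linear scale scale \<alpha> by (rule linear_twist)
  show "\<alpha> (x + y) = \<alpha> x + \<alpha> y" "\<alpha> (scale c x) = scale c (\<alpha> x)"
    by (rule add, rule scale)
qed

lemmas bilinear_simps = mult_add_left mult_scale_left mult_add_right mult_scale_right

abbreviation plus_mult (infixl "\<circ>\<^sub>+" 70) where
  "x \<circ>\<^sub>+ y \<equiv> plus_product scale A m x y"

lemma plus_product_even:
  assumes "x \<in> A i" "y \<in> A j"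
  shows "x \<circ>\<^sub>+ y \<in> A (i + j)"
proof -
  have "m y x \<in> A (i + j)"
    using mult_even[OF assms(2,1)] by (subst add.commute)
  then show ?thesis
    unfolding plus_product_homogeneous[OF assms]
    by (intro subspace_scale[OF subspace_component] subspace_add[OF subspace_component]
        mult_even[OF assms])
qed

lemma hom_superalgebra_plus: "hom_superalgebra scale A (plus_product scale A m) \<alpha>"
proof unfold_locales
  show "(x + x') \<circ>\<^sub>+ y = x \<circ>\<^sub>+ y + x' \<circ>\<^sub>+ y" for x x' y
    by (simp add: plus_product_def component_add bilinear_simps scale_right_distrib add_ac)
  show "scale c x \<circ>\<^sub>+ y = scale c (x \<circ>\<^sub>+ y)" for c x y
    by (simp add: plus_product_def component_scale bilinear_simps scale_right_distrib mult_ac)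
  show "x \<circ>\<^sub>+ (y + y') = x \<circ>\<^sub>+ y + x \<circ>\<^sub>+ y'" for x y y'
    by (simp add: plus_product_def component_add bilinear_simps scale_right_distrib add_ac)
  show "x \<circ>\<^sub>+ scale c y = scale c (x \<circ>\<^sub>+ y)" for c x y
    by (simp add: plus_product_def component_scale bilinear_simps scale_right_distrib mult_ac)
qed (fact plus_product_even twist_add twist_scale twist_even)+

lemma plus_product_supercommutative:
  assumes "x \<in> A i" "y \<in> A j"
  shows "x \<circ>\<^sub>+ y = scale (deg_sign (i * j)) (y \<circ>\<^sub>+ x)"
  unfolding plus_product_homogeneous[OF assms] plus_product_homogeneous[OF assms(2,1)]
  by (cases i; cases j) (simp_all add: deg_sign_def scale_right_distrib algebra_simps)

end

section \<open>Reduction to left-normed words and their cancellation\<close>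

locale multiplicative_right_hom_alternative_superalgebra =
  multiplicative_hom_superalgebra scale A m \<alpha> + right_hom_alternative_superalgebra scale A m \<alpha>
  for scale :: "'k::field \<Rightarrow> 'a::ab_group_add \<Rightarrow> 'a" and A m \<alpha>
begin

text \<open>In right Hom-alternativity, moving the terms with left factor \<open>\<alpha> w\<close>
  to one side collects exactly twice \<open>y \<circ>\<^sub>+ z\<close> behind that factor.\<close>

lemma right_mult_plus_product:
  assumes "w \<in> A i" "y \<in> A j" "z \<in> A k"
  shows "m (\<alpha> w) (y \<circ>\<^sub>+ z) =
    scale (1 / 2) (m (m w y) (\<alpha> z) + scale (deg_sign (j * k)) (m (m w z) (\<alpha> y)))"
proof -
  have "m (m w y) (\<alpha> z) - m (\<alpha> w) (m y z) =
    - scale (deg_sign (j * k)) (m (m w z) (\<alpha> y) - m (\<alpha> w) (m z y))"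
    using right_hom_alternative[OF assms] by (simp add: hom_associator_def)
  then have "m (\<alpha> w) (m y z) + scale (deg_sign (j * k)) (m (\<alpha> w) (m z y)) =
    m (m w y) (\<alpha> z) + scale (deg_sign (j * k)) (m (m w z) (\<alpha> y))"
    by (simp add: scale_right_diff_distrib algebra_simps)
  then show ?thesis
    by (simp add: plus_product_homogeneous[OF assms(2,3)] bilinear_simps)
qed

text \<open>The Hom-analogue of the monomial xyzt: the powers of \<alpha> are those that repeated
  use of \<open>right_mult_plus_product\<close> produces.\<close>

definition left_normed :: "'a \<Rightarrow> 'a \<Rightarrow> 'a \<Rightarrow> 'a \<Rightarrow> 'a" where
  "left_normed x y z t = m (m (m x y) (\<alpha> z)) (\<alpha> (\<alpha> t))"

lemma twist_plus_product:
  assumes "x \<in> A i" "y \<in> A j"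
  shows "\<alpha> (x \<circ>\<^sub>+ y) = \<alpha> x \<circ>\<^sub>+ \<alpha> y"
  using assms
  by (simp add: plus_product_homogeneous[OF assms] twist_add twist_scale twist_mult
      plus_product_homogeneous[OF twist_even[OF assms(1)] twist_even[OF assms(2)]])

text \<open>The expansion is the one valid in an associative superalgebra, each word carrying the
  Koszul sign of its permutation.\<close>

lemma plus_product_right_nested:
  assumes "x \<in> A i" "y \<in> A j" "z \<in> A k" "t \<in> A l"
  shows "((x \<circ>\<^sub>+ y) \<circ>\<^sub>+ \<alpha> z) \<circ>\<^sub>+ \<alpha> (\<alpha> t) = scale ((1 / 2) ^ 3)
    (left_normed x y z t + scale (deg_sign (i * j)) (left_normed y x z t)
     + scale (deg_sign (k * (i + j)))
        (left_normed z x y t + scale (deg_sign (i * j)) (left_normed z y x t))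
     + scale (deg_sign (l * (i + j + k)))
        (left_normed t x y z + scale (deg_sign (i * j)) (left_normed t y x z)
         + scale (deg_sign (k * (i + j)))
            (left_normed t z x y + scale (deg_sign (i * j)) (left_normed t z y x))))"
proof -
  note e = assms(1,2,3,4)[THEN twist_even]
  note ee = e[THEN twist_even]
  note xy = plus_product_even[OF assms(1,2)]
  note xyz = plus_product_even[OF xy e(3)]
  \<comment> \<open>Multiplicativity turns the left factor into \<open>\<alpha> (m t z)\<close>, the
    twisted form that \<open>right_mult_plus_product\<close> demands.\<close>
  have 1: "m (m (\<alpha> t) (\<alpha> z)) (\<alpha> (x \<circ>\<^sub>+ y)) = scale (1 / 2)
     (left_normed t z x y + scale (deg_sign (i * j)) (left_normed t z y x))"
    using right_mult_plus_product[OF mult_even[OF assms(4,3)] e(1,2)]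
    by (simp add: twist_plus_product[OF assms(1,2)] left_normed_def twist_mult)
  have "m (\<alpha> (\<alpha> t)) ((x \<circ>\<^sub>+ y) \<circ>\<^sub>+ \<alpha> z) = scale ((1 / 2) ^ 2)
        (left_normed t x y z + scale (deg_sign (i * j)) (left_normed t y x z)
         + scale (deg_sign (k * (i + j)))
            (left_normed t z x y + scale (deg_sign (i * j)) (left_normed t z y x)))"
    unfolding right_mult_plus_product[OF e(4) xy e(3)] 1 right_mult_plus_product[OF assms(4,1,2)]
    by (simp add: left_normed_def bilinear_simps scale_right_distrib power2_eq_square mult_ac)
  moreover have "m ((x \<circ>\<^sub>+ y) \<circ>\<^sub>+ \<alpha> z) (\<alpha> (\<alpha> t)) = scale ((1 / 2) ^ 2)
    (left_normed x y z t + scale (deg_sign (i * j)) (left_normed y x z t)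
     + scale (deg_sign (k * (i + j)))
        (left_normed z x y t + scale (deg_sign (i * j)) (left_normed z y x t)))"
    unfolding plus_product_homogeneous[OF xy e(3)]
    \<comment> \<open>This rewrites the product of \<open>\<alpha> z\<close> with
      \<open>x \<circ>\<^sub>+ y\<close> while the latter is still intact; only the occurrence of
      \<open>x \<circ>\<^sub>+ y\<close> as a left factor is then expanded by definition.\<close>
    unfolding right_mult_plus_product[OF assms(3,1,2)]
    unfolding plus_product_homogeneous[OF assms(1,2)]
    by (simp add: left_normed_def bilinear_simps scale_right_distrib power2_eq_square mult_ac)
  ultimately show ?thesis
    unfolding plus_product_homogeneous[OF xyz ee(4)]
    by (simp add: scale_right_distrib power2_eq_square power3_eq_cube mult_ac)
qed

text \<open>The left factor equals \<open>\<alpha> (x \<circ>\<^sub>+ y)\<close>, so the right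
  factor can be split as before; \<open>x \<circ>\<^sub>+ y\<close> then stands innermost on the
  left and is expanded directly.\<close>

lemma mult_plus_products:
  assumes "x \<in> A i" "y \<in> A j" "z \<in> A k" "t \<in> A l"
  shows "m (\<alpha> x \<circ>\<^sub>+ \<alpha> y) (\<alpha> z \<circ>\<^sub>+ \<alpha> t) = scale ((1 / 2) ^ 2)
    (left_normed x y z t + scale (deg_sign (i * j)) (left_normed y x z t)
     + scale (deg_sign (k * l))
        (left_normed x y t z + scale (deg_sign (i * j)) (left_normed y x t z)))"
  unfolding twist_plus_product[OF assms(1,2), symmetric]
    right_mult_plus_product[OF plus_product_even[OF assms(1,2)] assms(3,4)[THEN twist_even]]
  by (simp add: plus_product_homogeneous[OF assms(1,2)] left_normed_def bilinear_simps
      scale_right_distrib power2_eq_square mult_ac)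

lemma plus_product_balanced:
  assumes "x \<in> A i" "y \<in> A j" "z \<in> A k" "t \<in> A l"
  shows "(\<alpha> x \<circ>\<^sub>+ \<alpha> y) \<circ>\<^sub>+ (\<alpha> z \<circ>\<^sub>+ \<alpha> t) = scale ((1 / 2) ^ 3)
    (left_normed x y z t + scale (deg_sign (i * j)) (left_normed y x z t)
     + scale (deg_sign (k * l))
        (left_normed x y t z + scale (deg_sign (i * j)) (left_normed y x t z))
     + scale (deg_sign ((i + j) * (k + l)))
        (left_normed z t x y + scale (deg_sign (k * l)) (left_normed t z x y)
         + scale (deg_sign (i * j))
            (left_normed z t y x + scale (deg_sign (k * l)) (left_normed t z y x))))"
  unfolding plus_product_homogeneous[OF plus_product_even[OF assms(1,2)[THEN twist_even]]
      plus_product_even[OF assms(3,4)[THEN twist_even]]]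
    mult_plus_products[OF assms] mult_plus_products[OF assms(3,4,1,2)]
  by (simp add: scale_right_distrib power2_eq_square power3_eq_cube mult_ac)

text \<open>The words xyzt, yxzt, tzxy and tzyx occur in both products with equal signs and cancel.
  Read as associative monomials, the remaining eight form, up to sign and scalar, the double
  supercommutator [z, [x o y, t]], where o is the plus product.\<close>

lemma plus_hom_associator:
  assumes "x \<in> A i" "y \<in> A j" "z \<in> A k" "t \<in> A l"
  shows "hom_associator (plus_product scale A m) \<alpha> (x \<circ>\<^sub>+ y) (\<alpha> z) (\<alpha> t) = scale ((1 / 2) ^ 3)
    (scale (deg_sign (k * (i + j)))
        (left_normed z x y t + scale (deg_sign (i * j)) (left_normed z y x t))
     - scale (deg_sign ((i + j) * (k + l)))
        (left_normed z t x y + scale (deg_sign (i * j)) (left_normed z t y x))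
     + scale (deg_sign (l * (i + j + k)))
        (left_normed t x y z + scale (deg_sign (i * j)) (left_normed t y x z))
     - scale (deg_sign (k * l))
        (left_normed x y t z + scale (deg_sign (i * j)) (left_normed y x t z)))"
  unfolding hom_associator_def twist_plus_product[OF assms(1,2)]
    plus_product_right_nested[OF assms] plus_product_balanced[OF assms]
    scale_right_diff_distrib[symmetric]
  by (rule arg_cong[where f = "scale _"], cases i; cases j; cases k; cases l)
    (simp_all add: deg_sign_def scale_right_distrib algebra_simps)

text \<open>Formally, the signed cyclic sum of the supercommutators [x o y, t] vanishes, hence so
  does that of [z, [x o y, t]].\<close>

lemma hom_jordan_superalgebra_plus: "hom_jordan_superalgebra scale A (plus_product scale A m) \<alpha>"
proof -
  interpret plus: hom_superalgebra scale A "plus_product scale A m" \<alpha>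
    by (rule hom_superalgebra_plus)
  show ?thesis
  proof unfold_locales
    fix x y z t i j k l
    assume h: "x \<in> A i" "y \<in> A j" "z \<in> A k" "t \<in> A l"
    show "scale (deg_sign (l * (i + k)))
        (hom_associator (plus_product scale A m) \<alpha> (x \<circ>\<^sub>+ y) (\<alpha> z) (\<alpha> t)) +
      scale (deg_sign (i * (j + k)))
        (hom_associator (plus_product scale A m) \<alpha> (y \<circ>\<^sub>+ t) (\<alpha> z) (\<alpha> x)) +
      scale (deg_sign (j * (l + k)))
        (hom_associator (plus_product scale A m) \<alpha> (t \<circ>\<^sub>+ x) (\<alpha> z) (\<alpha> y)) = 0"
      unfolding plus_hom_associator[OF h] plus_hom_associator[OF h(2,4,3,1)]
        plus_hom_associator[OF h(4,1,3,2)]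
      \<comment> \<open>With the common scalar outside, 24 terms remain: twelve words with
        \<open>z\<close> first or last, each occurring twice. The sixteen choices of degrees confirm
        that the two signs are opposite.\<close>
      unfolding scale_left_commute[of _ "(1 / 2) ^ 3"] scale_right_distrib[symmetric]
      by (cases i; cases j; cases k; cases l)
        (simp_all add: deg_sign_def scale_right_distrib algebra_simps)
  qed (rule plus_product_supercommutative)
qed

end

theorem theorem4p1:
  fixes scale :: "'k::field \<Rightarrow> 'a::ab_group_add \<Rightarrow> 'a"
    and A :: "bit \<Rightarrow> 'a set"
    and m :: "'a \<Rightarrow> 'a \<Rightarrow> 'a"
    and \<alpha> :: "'a \<Rightarrow> 'a"
  assumes "CHAR('k) \<noteq> 2" and "CHAR('k) \<noteq> 3"
    and "multiplicative_hom_superalgebra scale A m \<alpha>"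
    and "right_hom_alternative_superalgebra scale A m \<alpha>"
  shows "hom_jordan_admissible scale A m \<alpha>"
proof -
  interpret multiplicative_right_hom_alternative_superalgebra scale A m \<alpha>
    using assms(3,4) by (rule multiplicative_right_hom_alternative_superalgebra.intro)
  show ?thesis
    unfolding hom_jordan_admissible_def by (rule hom_jordan_superalgebra_plus)
qed

end
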